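(* Let $R=\{(0,0),(0,1),(0,2),(3,0),(1,1),(1,3),(2,1),(2,2),(2,3),(3,3)\}$ and $R'=\{(0,0),(1,0),(2,0),(0,3),(1,1),(1,2),(2,2),(3,1),(3,2),(3,3)\}$. Then $(123,R)\sim_{jd}(132,R)$ and $(123,R')\sim_{jd}(132,R')$.
   Context: $S_n$ is the set of permutations $\pi=\pi_1\cdots\pi_n$ of $\{1,\dots,n\}$. A mesh pattern of length $k$ is a pair $(\tau,R)$ with $\tau\in S_k$ and $R\subseteq\{0,\dots,k\}\times\{0,\dots,k\}$ (the set of shaded boxes; box $(a,b)$ is the unit square with lower-left corner $(a,b)$). An occurrence of $(\tau,R)$ in $\pi\in S_n$ is a subsequence $\pi_{i_1}\cdots\pi_{i_k}$, $i_1<\dots<i_k$, order-isomorphic to $\tau$, such that, with $i_0=0$, $i_{k+1}=n+1$, with $v_1<\dots<v_k$ the values $\pi_{i_1},\dots,\pi_{i_k}$ in increasing order, and $v_0=0$, $v_{k+1}=n+1$, for each $(a,b)\in R$ there is no index $m$ with $i_a<m<i_{a+1}$ and $v_b<\pi_m<v_{b+1}$. Two mesh patterns $q_1,q_2$ are jointly equidistributed, written $q_1\sim_{jd}q_2$, if for all nonnegative integers $n,k,\ell$ the number of $\pi\in S_n$ with exactly $k$ occurrences of $q_1$ and $\ell$ occurrences of $q_2$ equals the number of $\pi\in S_n$ with exactly $\ell$ occurrences of $q_1$ and $k$ occurrences of $q_2$. *)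

theory Defs
  imports "HOL-Combinatorics.Multiset_Permutations"
begin

text \<open>
  A permutation of \<open>{1..n}\<close> is its one-line word, an element of
  \<^term>\<open>permutations_of_set {1..n::nat}\<close>.
  Positions are numbered from 1, whereas list indexing starts at 0.
\<close>

definition entry :: "nat list \<Rightarrow> nat \<Rightarrow> nat" where
  "entry \<pi> i = \<pi> ! (i - 1)"

type_synonym mesh_pattern = "nat list \<times> (nat \<times> nat) set"

definition is_mesh_pattern :: "mesh_pattern \<Rightarrow> bool" where
  "is_mesh_pattern = (\<lambda>(\<tau>, R).
     \<tau> \<in> permutations_of_set {1..length \<tau>} \<and> R \<subseteq> {0..length \<tau>} \<times> {0..length \<tau>})"

lemma is_mesh_pattern_123_132:
  assumes "R \<subseteq> {0..3} \<times> {0..3}"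
  shows "is_mesh_pattern ([1, 2, 3], R)" and "is_mesh_pattern ([1, 3, 2], R)"
  using assms by (auto simp: is_mesh_pattern_def permutations_of_set_def eval_nat_numeral)

definition order_isomorphic :: "nat list \<Rightarrow> nat list \<Rightarrow> bool" where
  "order_isomorphic u v \<longleftrightarrow> length u = length v \<and>
     (\<forall>i<length u. \<forall>j<length u. u ! i < u ! j \<longleftrightarrow> v ! i < v ! j)"

text \<open>
  The list \<open>is'\<close> holds the positions \<open>i\<^sub>1 < \<dots> < i\<^sub>k\<close> of the subsequence. The lists
  \<open>I = [i\<^sub>0, \<dots>, i\<^bsub>k+1\<^esub>]\<close> and \<open>V = [v\<^sub>0, \<dots>, v\<^bsub>k+1\<^esub>]\<close> include the boundary
  values \<open>0\<close> and \<open>n + 1\<close>.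
\<close>

definition mesh_occurrence :: "mesh_pattern \<Rightarrow> nat list \<Rightarrow> nat list \<Rightarrow> bool" where
  "mesh_occurrence = (\<lambda>(\<tau>, R) \<pi> is'.
     let n = length \<pi>;
         w = map (entry \<pi>) is';
         I = 0 # is' @ [n + 1];
         V = 0 # sort w @ [n + 1]
     in sorted_wrt (<) is' \<and> set is' \<subseteq> {1..n} \<and> order_isomorphic w \<tau> \<and>
        (\<forall>(a, b) \<in> R. \<not> (\<exists>m \<in> {1..n}. I ! a < m \<and> m < I ! (a + 1) \<and>
                                  V ! b < entry \<pi> m \<and> entry \<pi> m < V ! (b + 1))))"

definition num_occurrences :: "mesh_pattern \<Rightarrow> nat list \<Rightarrow> nat" where
  "num_occurrences q \<pi> = card {is'. mesh_occurrence q \<pi> is'}"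

definition jointly_equidistributed :: "mesh_pattern \<Rightarrow> mesh_pattern \<Rightarrow> bool"
    (infix "\<sim>\<^sub>j\<^sub>d" 50) where
  "q1 \<sim>\<^sub>j\<^sub>d q2 \<longleftrightarrow> (\<forall>n k l.
     card {\<pi> \<in> permutations_of_set {1..n}. num_occurrences q1 \<pi> = k \<and> num_occurrences q2 \<pi> = l} =
     card {\<pi> \<in> permutations_of_set {1..n}. num_occurrences q1 \<pi> = l \<and> num_occurrences q2 \<pi> = k})"

text \<open>The occurrence counts are cardinalities of finite sets.\<close>

lemma finite_mesh_occurrences: "finite {is'. mesh_occurrence q \<pi> is'}"
proof (rule finite_subset)
  show "{is'. mesh_occurrence q \<pi> is'} \<subseteq>
        {is'. set is' \<subseteq> {1..length \<pi>} \<and> length is' = length (fst q)}"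
    by (auto simp: mesh_occurrence_def order_isomorphic_def Let_def split: prod.splits)
qed (rule finite_lists_length_eq, simp)

end

theory Submission
  imports Defs
begin

text \<open>
  Exchanging the last two entries of an occurrence preserves the shaded region, which depends only
  on the positions and the set of values. So, for every shading, this matches the pairs
  (permutation, occurrence of \<open>123\<close>) with the pairs (permutation, occurrence of \<open>132\<close>).

  For \<open>R\<close>, each pattern occurs at most once in a permutation. By column 0 and row 3, the entries
  left of the first point of an occurrence are exactly those exceeding its largest value. If one
  occurrence started left of another one, the second would lie entirely below the first point of
  the first; box \<open>(3,0)\<close> puts the last point of the first occurrence right of the first point of
  the second, so it would lie below its own first point, a contradiction. Hence the first points
  agree, then the largest values agree, and column 2 forces the remaining point.

  So \<open>123\<close> and \<open>132\<close> are contained in equally many permutations of each length; removing those that contain both gives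
  joint equidistribution. Finally, \<open>R'\<close> is the transpose of \<open>R\<close> and both patterns are involutions,
  so uniqueness for \<open>R'\<close> follows by passing to inverse permutations.
\<close>

section \<open>Occurrences as points in a shaded grid\<close>

definition perm_graph :: "nat list \<Rightarrow> (nat \<times> nat) set" where
  "perm_graph \<pi> = (\<lambda>m. (m, entry \<pi> m)) ` {1..length \<pi>}"

text \<open>The grid lines are explicit lists in both directions and the points form an arbitrary
  relation, so transposing means taking converses and exchanging \<open>I\<close> with
  \<open>V\<close>.\<close>

definition avoids_shading :: "(nat \<times> nat) set \<Rightarrow> (nat \<times> nat) set \<Rightarrow> nat list \<Rightarrow> nat list \<Rightarrow> bool" where
  "avoids_shading R P I V \<longleftrightarrow> (\<forall>(i, j) \<in> R. \<forall>(x, y) \<in> P.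
     \<not> (I ! i < x \<and> x < I ! (i + 1) \<and> V ! j < y \<and> y < V ! (j + 1)))"

lemma avoids_shading_converse: "avoids_shading (R\<inverse>) (P\<inverse>) I V \<longleftrightarrow> avoids_shading R P V I"
  by (fastforce simp: avoids_shading_def)

lemma order_isomorphic_123:
  "order_isomorphic w [1, 2, 3] \<longleftrightarrow> (\<exists>x y z. w = [x, y, z] \<and> x < y \<and> y < z)"
  by (auto simp: order_isomorphic_def length_Suc_conv numeral_3_eq_3 less_Suc_eq)

lemma order_isomorphic_132:
  "order_isomorphic w [1, 3, 2] \<longleftrightarrow> (\<exists>x y z. w = [x, y, z] \<and> x < z \<and> z < y)"
  by (auto simp: order_isomorphic_def length_Suc_conv numeral_3_eq_3 less_Suc_eq)

lemma mesh_occurrence_iff_avoids_shading: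
  "mesh_occurrence (\<tau>, R) \<pi> is' \<longleftrightarrow>
     sorted_wrt (<) is' \<and> set is' \<subseteq> {1..length \<pi>} \<and> order_isomorphic (map (entry \<pi>) is') \<tau> \<and>
     avoids_shading R (perm_graph \<pi>) (0 # is' @ [length \<pi> + 1])
       (0 # sort (map (entry \<pi>) is') @ [length \<pi> + 1])"
  by (simp add: mesh_occurrence_def avoids_shading_def perm_graph_def Let_def)

lemma mesh_occurrence_123_iff:
  "mesh_occurrence ([1, 2, 3], R) \<pi> is' \<longleftrightarrow>
     (\<exists>a b c. is' = [a, b, c] \<and> 1 \<le> a \<and> a < b \<and> b < c \<and> c \<le> length \<pi> \<and>
        entry \<pi> a < entry \<pi> b \<and> entry \<pi> b < entry \<pi> c \<and>
        avoids_shading R (perm_graph \<pi>) [0, a, b, c, length \<pi> + 1]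
          [0, entry \<pi> a, entry \<pi> b, entry \<pi> c, length \<pi> + 1])"
  unfolding mesh_occurrence_iff_avoids_shading order_isomorphic_123
  by (auto simp: map_eq_Cons_conv)

lemma mesh_occurrence_132_iff:
  "mesh_occurrence ([1, 3, 2], R) \<pi> is' \<longleftrightarrow>
     (\<exists>a b c. is' = [a, b, c] \<and> 1 \<le> a \<and> a < b \<and> b < c \<and> c \<le> length \<pi> \<and>
        entry \<pi> a < entry \<pi> c \<and> entry \<pi> c < entry \<pi> b \<and>
        avoids_shading R (perm_graph \<pi>) [0, a, b, c, length \<pi> + 1]
          [0, entry \<pi> a, entry \<pi> c, entry \<pi> b, length \<pi> + 1])"
  unfolding mesh_occurrence_iff_avoids_shading order_isomorphic_132
  by (auto simp: map_eq_Cons_conv)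

section \<open>Exchanging the last two points of an occurrence\<close>

definition swap_entries :: "nat \<Rightarrow> nat \<Rightarrow> nat list \<Rightarrow> nat list" where
  "swap_entries b c \<pi> = \<pi>[b - 1 := entry \<pi> c, c - 1 := entry \<pi> b]"

lemma length_swap_entries [simp]: "length (swap_entries b c \<pi>) = length \<pi>"
  by (simp add: swap_entries_def)

lemma entry_swap_entries:
  assumes "1 \<le> b" "b < c" "c \<le> length \<pi>" "1 \<le> m"
  shows "entry (swap_entries b c \<pi>) m =
    (if m = b then entry \<pi> c else if m = c then entry \<pi> b else entry \<pi> m)"
  using assms by (auto simp: swap_entries_def entry_def nth_list_update)

lemma swap_entries_swap_entries:
  assumes "1 \<le> b" "b < c" "c \<le> length \<pi>"
  shows "swap_entries b c (swap_entries b c \<pi>) = \<pi>"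
  using assms by (intro nth_equalityI) (auto simp: swap_entries_def entry_def nth_list_update)

lemma swap_entries_in_permutations_of_set:
  assumes "1 \<le> b" "b < c" "c \<le> length \<pi>" "\<pi> \<in> permutations_of_set A"
  shows "swap_entries b c \<pi> \<in> permutations_of_set A"
proof -
  have "b - 1 < length \<pi>" "c - 1 < length \<pi>" using assms by auto
  then show ?thesis
    using assms(4) unfolding permutations_of_set_def swap_entries_def entry_def
    by (simp add: set_swap distinct_swap)
qed

text \<open>Boxes are open and the columns \<open>b\<close> and \<open>c\<close> are grid lines, so
  the two points that move lie in no box, before or after the exchange.\<close>

lemma avoids_shading_swap_entries:
  assumes R: "R \<subseteq> {0..3} \<times> {0..3}"
    and "1 \<le> a" "a < b" "b < c" "c \<le> length \<pi>"
    and av: "avoids_shading R (perm_graph \<pi>) [0, a, b, c, length \<pi> + 1] V"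
  shows "avoids_shading R (perm_graph (swap_entries b c \<pi>)) [0, a, b, c, length \<pi> + 1] V"
  unfolding avoids_shading_def
proof safe
  fix i j x y
  assume ij: "(i, j) \<in> R" and xy: "(x, y) \<in> perm_graph (swap_entries b c \<pi>)"
    and x: "[0, a, b, c, length \<pi> + 1] ! i < x" "x < [0, a, b, c, length \<pi> + 1] ! (i + 1)"
    and y: "V ! j < y" "y < V ! (j + 1)"
  have "i = 0 \<or> i = 1 \<or> i = 2 \<or> i = 3" using ij R by fastforce
  then have "x \<noteq> b" "x \<noteq> c" using x assms(2-5) by (auto simp: numeral_2_eq_2 numeral_3_eq_3)
  then have "(x, y) \<in> perm_graph \<pi>"
    using xy assms(2-5) by (auto simp: perm_graph_def entry_swap_entries)
  then show False using av ij x y unfolding avoids_shading_def by blast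
qed

text \<open>The new entries at \<open>c\<close> and \<open>b\<close> are the old ones at
  \<open>b\<close> and \<open>c\<close>, so the sorted values, and with them the grid, stay the
  same; only the order type changes.\<close>

lemma mesh_occurrence_swap_entries_123:
  assumes R: "R \<subseteq> {0..3} \<times> {0..3}" and "mesh_occurrence ([1, 2, 3], R) \<pi> [a, b, c]"
  shows "mesh_occurrence ([1, 3, 2], R) (swap_entries b c \<pi>) [a, b, c]"
  using assms avoids_shading_swap_entries[OF R, of a b c \<pi>]
  unfolding mesh_occurrence_123_iff mesh_occurrence_132_iff
  by (auto simp: entry_swap_entries)

lemma mesh_occurrence_swap_entries_132:
  assumes R: "R \<subseteq> {0..3} \<times> {0..3}" and "mesh_occurrence ([1, 3, 2], R) \<pi> [a, b, c]"
  shows "mesh_occurrence ([1, 2, 3], R) (swap_entries b c \<pi>) [a, b, c]"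
  using assms avoids_shading_swap_entries[OF R, of a b c \<pi>]
  unfolding mesh_occurrence_123_iff mesh_occurrence_132_iff
  by (auto simp: entry_swap_entries)

lemma card_occurrences_123_132:
  assumes R: "R \<subseteq> {0..3} \<times> {0..3}"
  shows "card (SIGMA \<pi> : permutations_of_set A. {is'. mesh_occurrence ([1, 2, 3], R) \<pi> is'}) =
    card (SIGMA \<pi> : permutations_of_set A. {is'. mesh_occurrence ([1, 3, 2], R) \<pi> is'})"
    (is "card ?T1 = card ?T2")
proof -
  \<comment> \<open>List indices 1 and 2 hold the second and third positions. Since \<open>F\<close>
    keeps the positions, it undoes itself.\<close>
  define F where "F = (\<lambda>(\<pi>, is'). (swap_entries (is' ! 1) (is' ! 2) \<pi>, is' :: nat list))"
  have occ1: "\<exists>a b c. is' = [a, b, c] \<and> 1 \<le> b \<and> b < c \<and> c \<le> length \<pi>"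
    if "mesh_occurrence ([1, 2, 3], R) \<pi> is'" for \<pi> is'
    using that unfolding mesh_occurrence_123_iff by auto
  have occ2: "\<exists>a b c. is' = [a, b, c] \<and> 1 \<le> b \<and> b < c \<and> c \<le> length \<pi>"
    if "mesh_occurrence ([1, 3, 2], R) \<pi> is'" for \<pi> is'
    using that unfolding mesh_occurrence_132_iff by auto
  have "bij_betw F ?T1 ?T2"
  proof (rule bij_betw_byWitness[where f' = F])
    show "\<forall>p \<in> ?T1. F (F p) = p"
      using occ1 by (fastforce simp: F_def swap_entries_swap_entries simp del: One_nat_def)
    show "\<forall>p \<in> ?T2. F (F p) = p"
      using occ2 by (fastforce simp: F_def swap_entries_swap_entries simp del: One_nat_def)
    show "F ` ?T1 \<subseteq> ?T2"
    proof safe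
      fix \<pi> is' \<sigma> js
      assume *: "(\<sigma>, js) = F (\<pi>, is')" "\<pi> \<in> permutations_of_set A"
        "mesh_occurrence ([1, 2, 3], R) \<pi> is'"
      then obtain a b c where "is' = [a, b, c]" "1 \<le> b" "b < c" "c \<le> length \<pi>"
        using occ1 by blast
      with * mesh_occurrence_swap_entries_123[OF R, of \<pi> a b c]
      show "\<sigma> \<in> permutations_of_set A" "mesh_occurrence ([1, 3, 2], R) \<sigma> js"
        by (auto simp: F_def swap_entries_in_permutations_of_set)
    qed
    show "F ` ?T2 \<subseteq> ?T1"
    proof safe
      fix \<pi> is' \<sigma> js
      assume *: "(\<sigma>, js) = F (\<pi>, is')" "\<pi> \<in> permutations_of_set A"
        "mesh_occurrence ([1, 3, 2], R) \<pi> is'"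
      then obtain a b c where "is' = [a, b, c]" "1 \<le> b" "b < c" "c \<le> length \<pi>"
        using occ2 by blast
      with * mesh_occurrence_swap_entries_132[OF R, of \<pi> a b c]
      show "\<sigma> \<in> permutations_of_set A" "mesh_occurrence ([1, 2, 3], R) \<sigma> js"
        by (auto simp: F_def swap_entries_in_permutations_of_set)
    qed
  qed
  then show ?thesis by (rule bij_betw_same_card)
qed

section \<open>From total counts to the joint distribution\<close>

lemma card_occurrences_eq_sum:
  "finite A \<Longrightarrow> card (SIGMA \<pi> : A. {is'. mesh_occurrence q \<pi> is'}) = (\<Sum>\<pi>\<in>A. num_occurrences q \<pi>)"
  by (simp add: num_occurrences_def finite_mesh_occurrences)

text \<open>With counts 0 or 1, the sums are the sizes of \<open>A1\<close> and \<open>A2\<close>.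
  The only asymmetric pairs of counts that can arise are (1,0) and (0,1), and finite sets of equal
  size have set differences of equal size.\<close>

lemma jointly_equidistributed_if_at_most_one:
  assumes sum: "\<And>n. (\<Sum>\<pi>\<in>permutations_of_set {1..n}. num_occurrences q1 \<pi>) =
      (\<Sum>\<pi>\<in>permutations_of_set {1..n}. num_occurrences q2 \<pi>)"
    and le1: "\<And>n \<pi>. \<pi> \<in> permutations_of_set {1..n} \<Longrightarrow> num_occurrences q1 \<pi> \<le> 1"
    and le2: "\<And>n \<pi>. \<pi> \<in> permutations_of_set {1..n} \<Longrightarrow> num_occurrences q2 \<pi> \<le> 1"
  shows "q1 \<sim>\<^sub>j\<^sub>d q2"
  unfolding jointly_equidistributed_def
proof (intro allI)
  fix n k l :: nat
  let ?S = "permutations_of_set {1..n}"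
  let ?N = "\<lambda>k l. {\<pi> \<in> ?S. num_occurrences q1 \<pi> = k \<and> num_occurrences q2 \<pi> = l}"
  define A1 where "A1 = {\<pi> \<in> ?S. num_occurrences q1 \<pi> = 1}"
  define A2 where "A2 = {\<pi> \<in> ?S. num_occurrences q2 \<pi> = 1}"
  have 01: "num_occurrences q1 \<pi> = 0 \<or> num_occurrences q1 \<pi> = 1"
    "num_occurrences q2 \<pi> = 0 \<or> num_occurrences q2 \<pi> = 1" if "\<pi> \<in> ?S" for \<pi>
    using le1[OF that] le2[OF that] by linarith+
  have "(\<Sum>\<pi>\<in>?S. num_occurrences q1 \<pi>) = (\<Sum>\<pi>\<in>?S. if num_occurrences q1 \<pi> = 1 then 1 else 0)"
    "(\<Sum>\<pi>\<in>?S. num_occurrences q2 \<pi>) = (\<Sum>\<pi>\<in>?S. if num_occurrences q2 \<pi> = 1 then 1 else 0)"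
    by (intro sum.cong refl; use 01 in fastforce)+
  then have A: "card A1 = card A2"
    using sum[of n] by (simp add: A1_def A2_def sum.If_cases Collect_conj_eq Int_commute)
  have "?N 1 0 = A1 - A2" "?N 0 1 = A2 - A1"
    using 01 by (auto simp: A1_def A2_def)
  moreover have "finite A1" "finite A2"
    by (auto simp: A1_def A2_def)
  ultimately have eq: "card (?N 1 0) = card (?N 0 1)"
    using A by (simp add: card_Diff_subset_Int Int_commute)
  consider "k = l" | "k = 1 \<and> l = 0" | "k = 0 \<and> l = 1" | "k > 1 \<or> l > 1"
    by linarith
  then show "card (?N k l) = card (?N l k)"
  proof cases
    case 4
    then have "?N k l = {}" "?N l k = {}" using le1 le2 by fastforce+
    then show ?thesis by (simp only:)
  qed (use eq in auto)
qed

section \<open>Uniqueness of the occurrence for \<open>R\<close>\<close>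

text \<open>
  The points are those of two occurrences of the same pattern, with positions \<open>a < b < c\<close> and
  sorted values \<open>u < v < w\<close>; the two disjuncts of the last hypothesis are \<open>123\<close> and \<open>132\<close>. Using a
  relation \<open>P\<close> instead of a word makes the lemma applicable to the inverse permutation.
\<close>

lemma occurrence_points_unique:
  fixes P :: "(nat \<times> nat) set"
  defines "R \<equiv> {(0,0), (0,1), (0,2), (3,0), (1,1), (1,3), (2,1), (2,2), (2,3), (3,3)}"
  assumes P: "single_valued P" "single_valued (P\<inverse>)" "P \<subseteq> {1..n} \<times> {1..n}"
    and o: "a < b" "b < c" "u < v" "v < w" "(a, u) \<in> P"
      "avoids_shading R P [0, a, b, c, n + 1] [0, u, v, w, n + 1]"
    and o': "a' < b'" "b' < c'" "u' < v'" "v' < w'" "(a', u') \<in> P"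
      "avoids_shading R P [0, a', b', c', n + 1] [0, u', v', w', n + 1]"
    and bc: "(b, v) \<in> P \<and> (c, w) \<in> P \<and> (b', v') \<in> P \<and> (c', w') \<in> P \<or>
      (b, w) \<in> P \<and> (c, v) \<in> P \<and> (b', w') \<in> P \<and> (c', v') \<in> P"
  shows "a = a' \<and> b = b' \<and> c = c'"
proof -
  have inj: "x = x' \<longleftrightarrow> y = y'" if "(x, y) \<in> P" "(x', y') \<in> P" for x y x' y'
    using that P unfolding single_valued_def by blast
  have bnd: "0 < x \<and> x < n + 1 \<and> 0 < y \<and> y < n + 1" if "(x, y) \<in> P" for x y
    using that P(3) by force
  \<comment> \<open>Stated for a generic occurrence, to serve both given ones.\<close>
  have facts: "x < a \<longleftrightarrow> w < y" "y < u \<Longrightarrow> x < c" "b < x \<Longrightarrow> x < c \<Longrightarrow> y < u"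
    if "(x, y) \<in> P" "a < b" "b < c" "u < v" "v < w" "(a, u) \<in> P"
      "avoids_shading R P [0, a, b, c, n + 1] [0, u, v, w, n + 1]"
      "(b, v) \<in> P \<and> (c, w) \<in> P \<or> (b, w) \<in> P \<and> (c, v) \<in> P" for x y a b c u v w
  proof -
    have box: "\<not> (x < a \<and> y < u)" "\<not> (x < a \<and> u < y \<and> y < v)" "\<not> (x < a \<and> v < y \<and> y < w)"
      "\<not> (c < x \<and> y < u)" "\<not> (a < x \<and> x < b \<and> w < y)" "\<not> (b < x \<and> x < c \<and> u < y \<and> y < v)"
      "\<not> (b < x \<and> x < c \<and> v < y \<and> y < w)" "\<not> (b < x \<and> x < c \<and> w < y)" "\<not> (c < x \<and> w < y)"
      using that(1,7) bnd[OF that(1)]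
      by (auto simp: avoids_shading_def R_def numeral_2_eq_2 numeral_3_eq_3)
    \<comment> \<open>Boxes are open, so points on grid lines need separate treatment: those on one
      of the three columns are exactly those on one of the three rows.\<close>
    have ne: "x \<noteq> a \<and> x \<noteq> b \<and> x \<noteq> c \<longleftrightarrow> y \<noteq> u \<and> y \<noteq> v \<and> y \<noteq> w"
      using inj that(1,6,8) by blast
    \<comment> \<open>Column 0 is shaded except for its top box, and row 3 except for its leftmost
      box, which is the same box (0,3).\<close>
    show "x < a \<longleftrightarrow> w < y"
    proof
      assume "x < a"
      moreover from this have "y \<noteq> u" "y \<noteq> v" "y \<noteq> w" using ne that(2-5) by linarith+
      ultimately show "w < y" using box(1-3) by linarith
    next
      assume "w < y"
      moreover from this have "x \<noteq> a" "x \<noteq> b" "x \<noteq> c" using ne that(2-5) by linarith+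
      ultimately show "x < a" using box(5,8,9) by linarith
    qed
    show "x < c" if "y < u"
      using box(4) ne that \<open>u < v\<close> \<open>v < w\<close> by linarith
    \<comment> \<open>Column 2 is shaded in every row but row 0.\<close>
    show "y < u" if "b < x" "x < c"
    proof -
      have "y \<noteq> u" "y \<noteq> v" "y \<noteq> w" using ne that \<open>a < b\<close> by linarith+
      then show ?thesis using box(6-8) that by linarith
    qed
  qed
  have bc1: "(b, v) \<in> P \<and> (c, w) \<in> P \<or> (b, w) \<in> P \<and> (c, v) \<in> P"
    and bc2: "(b', v') \<in> P \<and> (c', w') \<in> P \<or> (b', w') \<in> P \<and> (c', v') \<in> P"
    using bc by blast+
  note f = facts[OF _ o bc1] and f' = facts[OF _ o' bc2]
  have aa: "a = a'"
  proof (rule ccontr)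
    assume "a \<noteq> a'"
    then consider "a < a'" | "a' < a" by linarith
    then show False
    proof cases
      \<comment> \<open>The point \<open>(a, u)\<close> is left of \<open>a'\<close>, hence above
        \<open>w'\<close>. The point in column \<open>c\<close> is higher still, so it would have to
        lie left of \<open>a'\<close>, against \<open>a' < c\<close>.\<close>
      case 1
      then have "w' < u" using f'(1)[OF o(5)] by blast
      then have "a' < c" using f(2)[OF o'(5)] o' by linarith
      then show False
        using bc1 f'(1)[of c v] f'(1)[of c w] \<open>w' < u\<close> o by (metis less_asym less_trans)
    next
      case 2
      then have "w < u'" using f(1)[OF o'(5)] by blast
      then have "a < c'" using f'(2)[OF o(5)] o by linarith
      then show False
        using bc2 f(1)[of c' v'] f(1)[of c' w'] \<open>w < u'\<close> o' by (metis less_asym less_trans)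
    qed
  qed
  then have uu: "u = u'" using inj o(5) o'(5) by blast
  \<comment> \<open>No top point lies left of the common first column, so neither of
    \<open>w\<close> and \<open>w'\<close> exceeds the other.\<close>
  have ww: "w = w'"
    using bc f(1)[of b' w'] f(1)[of c' w'] f'(1)[of b w] f'(1)[of c w] aa o o'
    by (metis less_asym less_trans linorder_neqE_nat)
  from bc show ?thesis
  proof
    assume p: "(b, v) \<in> P \<and> (c, w) \<in> P \<and> (b', v') \<in> P \<and> (c', w') \<in> P"
    then have cc: "c = c'" using ww inj by blast
    \<comment> \<open>If \<open>b\<close> and \<open>b'\<close> differed, the larger would lie in
      column 2 of the other occurrence, forcing its point below the common lowest value.\<close>
    have "b = b'"
      using f(3)[of b' v'] f'(3)[of b v] p cc uu o o'
      by (metis less_asym linorder_neqE_nat)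
    with aa cc show ?thesis by simp
  next
    assume p: "(b, w) \<in> P \<and> (c, v) \<in> P \<and> (b', w') \<in> P \<and> (c', v') \<in> P"
    then have bb: "b = b'" using ww inj by blast
    have "c = c'"
      using f(3)[of c' v'] f'(3)[of c v] p bb uu o o'
      by (metis less_asym linorder_neqE_nat)
    with aa bb show ?thesis by simp
  qed
qed

section \<open>Transfer to permutations and conclusion\<close>

lemma perm_graph_permutation:
  assumes "\<pi> \<in> permutations_of_set {1..n}"
  shows "length \<pi> = n" "single_valued (perm_graph \<pi>)" "single_valued ((perm_graph \<pi>)\<inverse>)"
    "perm_graph \<pi> \<subseteq> {1..n} \<times> {1..n}"
proof -
  have d: "distinct \<pi>" and s: "set \<pi> = {1..n}"
    using assms by (auto simp: permutations_of_set_def)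
  show n: "length \<pi> = n" using distinct_card[OF d] s by simp
  show "single_valued (perm_graph \<pi>)"
    by (auto simp: single_valued_def perm_graph_def)
  show "single_valued ((perm_graph \<pi>)\<inverse>)"
    using d by (auto simp: single_valued_def perm_graph_def entry_def nth_eq_iff_index_eq)
  have "entry \<pi> m \<in> {1..n}" if "m \<in> {1..n}" for m
    unfolding s[symmetric] entry_def using that n by (intro nth_mem) auto
  then show "perm_graph \<pi> \<subseteq> {1..n} \<times> {1..n}"
    using n by (auto simp: perm_graph_def)
qed

lemma num_occurrences_le_1:
  assumes "\<And>is' js. mesh_occurrence q \<pi> is' \<Longrightarrow> mesh_occurrence q \<pi> js \<Longrightarrow> is' = js"
  shows "num_occurrences q \<pi> \<le> 1"
  unfolding num_occurrences_def using assms
  by (intro card_le_Suc0_iff_eq[THEN iffD2, folded One_nat_def]) (auto intro: finite_mesh_occurrences)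

text \<open>Isolates uniqueness as the only input that depends on the shading, so that
  \<open>R\<close> and \<open>R'\<close> share the rest.\<close>

lemma jointly_equidistributed_123_132:
  assumes R: "R \<subseteq> {0..3} \<times> {0..3}"
    and unique: "\<And>P n a b c u v w a' b' c' u' v' w'.
      \<lbrakk>single_valued P; single_valued (P\<inverse>); P \<subseteq> {1..n} \<times> {1..n};
       a < b; b < c; u < v; v < w; (a, u) \<in> P;
       avoids_shading R P [0, a, b, c, n + 1] [0, u, v, w, n + 1];
       a' < b'; b' < c'; u' < v'; v' < w'; (a', u') \<in> P;
       avoids_shading R P [0, a', b', c', n + 1] [0, u', v', w', n + 1];
       (b, v) \<in> P \<and> (c, w) \<in> P \<and> (b', v') \<in> P \<and> (c', w') \<in> P \<or>
       (b, w) \<in> P \<and> (c, v) \<in> P \<and> (b', w') \<in> P \<and> (c', v') \<in> P\<rbrakk>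
      \<Longrightarrow> a = a' \<and> b = b' \<and> c = c'"
  shows "([1, 2, 3], R) \<sim>\<^sub>j\<^sub>d ([1, 3, 2], R)"
proof (rule jointly_equidistributed_if_at_most_one)
  fix n
  show "(\<Sum>\<pi>\<in>permutations_of_set {1..n}. num_occurrences ([1, 2, 3], R) \<pi>) =
      (\<Sum>\<pi>\<in>permutations_of_set {1..n}. num_occurrences ([1, 3, 2], R) \<pi>)"
    using card_occurrences_123_132[OF R, of "{1..n}"]
    by (simp only: card_occurrences_eq_sum finite_permutations_of_set)
next
  fix n :: nat and \<pi> :: "nat list"
  assume "\<pi> \<in> permutations_of_set {1..n}"
  note g = perm_graph_permutation[OF this]
  have mem: "(m, entry \<pi> m) \<in> perm_graph \<pi>" if "1 \<le> m" "m \<le> n" for m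
    using that g(1) by (auto simp: perm_graph_def)
  show "num_occurrences ([1, 2, 3], R) \<pi> \<le> 1"
  proof (rule num_occurrences_le_1)
    fix is' js
    assume "mesh_occurrence ([1, 2, 3], R) \<pi> is'" "mesh_occurrence ([1, 2, 3], R) \<pi> js"
    then obtain a b c a' b' c' where
      o: "is' = [a, b, c]" "1 \<le> a" "a < b" "b < c" "c \<le> n"
        "entry \<pi> a < entry \<pi> b" "entry \<pi> b < entry \<pi> c"
        "avoids_shading R (perm_graph \<pi>) [0, a, b, c, n + 1] [0, entry \<pi> a, entry \<pi> b, entry \<pi> c, n + 1]"
      and o': "js = [a', b', c']" "1 \<le> a'" "a' < b'" "b' < c'" "c' \<le> n"
        "entry \<pi> a' < entry \<pi> b'" "entry \<pi> b' < entry \<pi> c'"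
        "avoids_shading R (perm_graph \<pi>) [0, a', b', c', n + 1] [0, entry \<pi> a', entry \<pi> b', entry \<pi> c', n + 1]"
      unfolding mesh_occurrence_123_iff g(1) by blast
    have "a = a' \<and> b = b' \<and> c = c'"
      by (rule unique[OF g(2-4) o(3,4,6,7) mem o(8) o'(3,4,6,7) mem o'(8)])
        (use o(2-5) o'(2-5) in \<open>auto intro!: mem\<close>)
    then show "is' = js" using o(1) o'(1) by simp
  qed
  show "num_occurrences ([1, 3, 2], R) \<pi> \<le> 1"
  proof (rule num_occurrences_le_1)
    fix is' js
    assume "mesh_occurrence ([1, 3, 2], R) \<pi> is'" "mesh_occurrence ([1, 3, 2], R) \<pi> js"
    then obtain a b c a' b' c' where
      o: "is' = [a, b, c]" "1 \<le> a" "a < b" "b < c" "c \<le> n"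
        "entry \<pi> a < entry \<pi> c" "entry \<pi> c < entry \<pi> b"
        "avoids_shading R (perm_graph \<pi>) [0, a, b, c, n + 1] [0, entry \<pi> a, entry \<pi> c, entry \<pi> b, n + 1]"
      and o': "js = [a', b', c']" "1 \<le> a'" "a' < b'" "b' < c'" "c' \<le> n"
        "entry \<pi> a' < entry \<pi> c'" "entry \<pi> c' < entry \<pi> b'"
        "avoids_shading R (perm_graph \<pi>) [0, a', b', c', n + 1] [0, entry \<pi> a', entry \<pi> c', entry \<pi> b', n + 1]"
      unfolding mesh_occurrence_132_iff g(1) by blast
    have "a = a' \<and> b = b' \<and> c = c'"
      by (rule unique[OF g(2-4) o(3,4,6,7) mem o(8) o'(3,4,6,7) mem o'(8)])
        (use o(2-5) o'(2-5) in \<open>auto intro!: mem\<close>)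
    then show "is' = js" using o(1) o'(1) by simp
  qed
qed

theorem theorem3p7:
  fixes R R' :: "(nat \<times> nat) set"
  assumes "R = {(0,0), (0,1), (0,2), (3,0), (1,1), (1,3), (2,1), (2,2), (2,3), (3,3)}"
    and "R' = {(0,0), (1,0), (2,0), (0,3), (1,1), (1,2), (2,2), (3,1), (3,2), (3,3)}"
  shows "([1, 2, 3], R) \<sim>\<^sub>j\<^sub>d ([1, 3, 2], R) \<and> ([1, 2, 3], R') \<sim>\<^sub>j\<^sub>d ([1, 3, 2], R')"
proof
  show "([1, 2, 3], R) \<sim>\<^sub>j\<^sub>d ([1, 3, 2], R)"
  proof (rule jointly_equidistributed_123_132)
    show "R \<subseteq> {0..3} \<times> {0..3}" by (simp add: assms(1))
  qed (rule occurrence_points_unique[folded assms(1)])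
  have R': "R' = R\<inverse>" by (auto simp: assms)
  show "([1, 2, 3], R') \<sim>\<^sub>j\<^sub>d ([1, 3, 2], R')"
  proof (rule jointly_equidistributed_123_132)
    show "R' \<subseteq> {0..3} \<times> {0..3}" by (simp add: assms(2))
    fix P :: "(nat \<times> nat) set" and n a b c u v w a' b' c' u' v' w' :: nat
    assume P: "single_valued P" "single_valued (P\<inverse>)" "P \<subseteq> {1..n} \<times> {1..n}"
      and o: "a < b" "b < c" "u < v" "v < w" "(a, u) \<in> P"
        "avoids_shading R' P [0, a, b, c, n + 1] [0, u, v, w, n + 1]"
      and o': "a' < b'" "b' < c'" "u' < v'" "v' < w'" "(a', u') \<in> P"
        "avoids_shading R' P [0, a', b', c', n + 1] [0, u', v', w', n + 1]"
      and bc: "(b, v) \<in> P \<and> (c, w) \<in> P \<and> (b', v') \<in> P \<and> (c', w') \<in> P \<or>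
        (b, w) \<in> P \<and> (c, v) \<in> P \<and> (b', w') \<in> P \<and> (c', v') \<in> P"
    \<comment> \<open>In the converse relation values act as positions. Each disjunct of
      \<open>bc\<close> is carried to itself, as both patterns are involutions.\<close>
    have "u = u' \<and> v = v' \<and> w = w'"
    proof (rule occurrence_points_unique[folded assms(1)])
      show "single_valued (P\<inverse>)" "single_valued ((P\<inverse>)\<inverse>)" "P\<inverse> \<subseteq> {1..n} \<times> {1..n}"
        using P by auto
      show "avoids_shading R (P\<inverse>) [0, u, v, w, n + 1] [0, a, b, c, n + 1]"
        "avoids_shading R (P\<inverse>) [0, u', v', w', n + 1] [0, a', b', c', n + 1]"
        using o(6) o'(6) avoids_shading_converse[of R "P\<inverse>"] by (simp_all add: R')
    qed (use o o' bc in auto)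
    \<comment> \<open>Each value is taken at only one position, so equal values give equal
      positions.\<close>
    then show "a = a' \<and> b = b' \<and> c = c'"
      using o(5) o'(5) bc P(2) unfolding single_valued_def by blast
  qed
qed

end
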